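(* Let $G$ be a group. Suppose there exist a choice of generators $\Sigma^*\to G$, a combing $R\subset\Sigma^*$, and a constant $C$ such that every $R$-triangle $T$ in $G$ satisfies $\delta(T)\le |T|/75+C$. Then $G$ is word hyperbolic.
   Context: A choice of generators for $G$ consists of a finite alphabet $\Sigma$ with formal inverses (a fixed-point-free involution $a\mapsto a^{-1}$ on $\Sigma$, extended by $(wv)^{-1}=v^{-1}w^{-1}$) and a surjective monoid homomorphism $\Sigma^*\to G$, $w\mapsto\overline w$, with $\overline{w^{-1}}=\overline w^{-1}$. A combing is a language $R\subset\Sigma^*$ mapping onto $G$. A path of length $n$ in $G$ is a sequence $g_0,\dots,g_n$ with $g_i=g_{i-1}\overline{a_i}$ for some $a_i\in\Sigma$; its label is $a_1\cdots a_n$. $d(g,h)$ is the length of a shortest path from $g$ to $h$ (the word metric). A triangle $T$ consists of three points of $G$ joined pairwise by paths (its sides); it is an $R$-triangle if the labels of its sides lie in $R$. $T$ is $\delta$-thin if every point on one side is at distance at most $\delta$ from the union of the other two sides; the width $\delta(T)$ is the smallest such $\delta$; the norm $|T|$ is the maximum distance between its vertices. *)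

theory Defs
  imports Complex_Main "HOL-Algebra.Group"
begin

definition weval :: "('g, 'b) monoid_scheme \<Rightarrow> ('a \<Rightarrow> 'g) \<Rightarrow> 'a list \<Rightarrow> 'g" where
  "weval G e w = foldr (\<lambda>a x. e a \<otimes>\<^bsub>G\<^esub> x) w \<one>\<^bsub>G\<^esub>"

definition gen_choice :: "('g, 'b) monoid_scheme \<Rightarrow> 'a set \<Rightarrow> ('a \<Rightarrow> 'a) \<Rightarrow> ('a \<Rightarrow> 'g) \<Rightarrow> bool" where
  "gen_choice G S iv e \<longleftrightarrow> finite S \<and>
     (\<forall>a\<in>S. iv a \<in> S \<and> iv a \<noteq> a \<and> iv (iv a) = a \<and> e a \<in> carrier G \<and> e (iv a) = inv\<^bsub>G\<^esub> (e a)) \<and>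
     (\<forall>g\<in>carrier G. \<exists>w\<in>lists S. weval G e w = g)"

definition combing :: "('g, 'b) monoid_scheme \<Rightarrow> 'a set \<Rightarrow> ('a \<Rightarrow> 'g) \<Rightarrow> 'a list set \<Rightarrow> bool" where
  "combing G S e R \<longleftrightarrow> R \<subseteq> lists S \<and> (\<forall>g\<in>carrier G. \<exists>w\<in>R. weval G e w = g)"

definition wdist :: "('g, 'b) monoid_scheme \<Rightarrow> 'a set \<Rightarrow> ('a \<Rightarrow> 'g) \<Rightarrow> 'g \<Rightarrow> 'g \<Rightarrow> nat" where
  "wdist G S e g h = (LEAST n. \<exists>w\<in>lists S. length w = n \<and> g \<otimes>\<^bsub>G\<^esub> weval G e w = h)"

text \<open>A path is given by its starting point and its label; its points are
  g_i = g_0 * eval(a_1 ... a_i), i = 0..n.\<close>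
definition path_end :: "('g, 'b) monoid_scheme \<Rightarrow> ('a \<Rightarrow> 'g) \<Rightarrow> 'g \<times> 'a list \<Rightarrow> 'g" where
  "path_end G e p = fst p \<otimes>\<^bsub>G\<^esub> weval G e (snd p)"

definition path_pts :: "('g, 'b) monoid_scheme \<Rightarrow> ('a \<Rightarrow> 'g) \<Rightarrow> 'g \<times> 'a list \<Rightarrow> 'g set" where
  "path_pts G e p = {fst p \<otimes>\<^bsub>G\<^esub> weval G e (take i (snd p)) | i. i \<le> length (snd p)}"

definition joins :: "('g, 'b) monoid_scheme \<Rightarrow> 'a set \<Rightarrow> ('a \<Rightarrow> 'g) \<Rightarrow> 'g \<times> 'a list \<Rightarrow> 'g \<Rightarrow> 'g \<Rightarrow> bool" where
  "joins G S e p x y \<longleftrightarrow> fst p \<in> carrier G \<and> snd p \<in> lists S \<and>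
     ((fst p = x \<and> path_end G e p = y) \<or> (fst p = y \<and> path_end G e p = x))"

definition triangle :: "('g, 'b) monoid_scheme \<Rightarrow> 'a set \<Rightarrow> ('a \<Rightarrow> 'g) \<Rightarrow> 'g \<Rightarrow> 'g \<Rightarrow> 'g \<Rightarrow>
    'g \<times> 'a list \<Rightarrow> 'g \<times> 'a list \<Rightarrow> 'g \<times> 'a list \<Rightarrow> bool" where
  "triangle G S e x y z s1 s2 s3 \<longleftrightarrow> joins G S e s1 x y \<and> joins G S e s2 y z \<and> joins G S e s3 z x"

definition R_triangle :: "('g, 'b) monoid_scheme \<Rightarrow> 'a set \<Rightarrow> ('a \<Rightarrow> 'g) \<Rightarrow> 'a list set \<Rightarrow> 'g \<Rightarrow> 'g \<Rightarrow> 'g \<Rightarrow>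
    'g \<times> 'a list \<Rightarrow> 'g \<times> 'a list \<Rightarrow> 'g \<times> 'a list \<Rightarrow> bool" where
  "R_triangle G S e R x y z s1 s2 s3 \<longleftrightarrow> triangle G S e x y z s1 s2 s3 \<and>
     snd s1 \<in> R \<and> snd s2 \<in> R \<and> snd s3 \<in> R"

definition thin :: "('g, 'b) monoid_scheme \<Rightarrow> 'a set \<Rightarrow> ('a \<Rightarrow> 'g) \<Rightarrow>
    'g \<times> 'a list \<Rightarrow> 'g \<times> 'a list \<Rightarrow> 'g \<times> 'a list \<Rightarrow> real \<Rightarrow> bool" where
  "thin G S e s1 s2 s3 d \<longleftrightarrow>
     (\<forall>p\<in>path_pts G e s1. \<exists>q\<in>path_pts G e s2 \<union> path_pts G e s3. real (wdist G S e p q) \<le> d) \<and>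
     (\<forall>p\<in>path_pts G e s2. \<exists>q\<in>path_pts G e s1 \<union> path_pts G e s3. real (wdist G S e p q) \<le> d) \<and>
     (\<forall>p\<in>path_pts G e s3. \<exists>q\<in>path_pts G e s1 \<union> path_pts G e s2. real (wdist G S e p q) \<le> d)"

text \<open>Width: the smallest delta for which the triangle is delta-thin (distances are
  natural numbers, so this minimum is attained at a natural number).\<close>
definition width :: "('g, 'b) monoid_scheme \<Rightarrow> 'a set \<Rightarrow> ('a \<Rightarrow> 'g) \<Rightarrow>
    'g \<times> 'a list \<Rightarrow> 'g \<times> 'a list \<Rightarrow> 'g \<times> 'a list \<Rightarrow> nat" where
  "width G S e s1 s2 s3 = (LEAST n::nat. thin G S e s1 s2 s3 (real n))"

definition tnorm :: "('g, 'b) monoid_scheme \<Rightarrow> 'a set \<Rightarrow> ('a \<Rightarrow> 'g) \<Rightarrow> 'g \<Rightarrow> 'g \<Rightarrow> 'g \<Rightarrow> nat" where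
  "tnorm G S e x y z = max (wdist G S e x y) (max (wdist G S e y z) (wdist G S e z x))"

definition geodesic :: "('g, 'b) monoid_scheme \<Rightarrow> 'a set \<Rightarrow> ('a \<Rightarrow> 'g) \<Rightarrow> 'g \<times> 'a list \<Rightarrow> bool" where
  "geodesic G S e p \<longleftrightarrow> length (snd p) = wdist G S e (fst p) (path_end G e p)"

definition word_hyperbolic :: "('g, 'b) monoid_scheme \<Rightarrow> bool" where
  "word_hyperbolic G \<longleftrightarrow> (\<exists>S \<delta>::real. S \<subseteq> carrier G \<and> finite S \<and> (\<forall>s\<in>S. inv\<^bsub>G\<^esub> s \<in> S) \<and>
     (\<forall>g\<in>carrier G. \<exists>w\<in>lists S. weval G id w = g) \<and>
     (\<forall>x y z s1 s2 s3. triangle G S id x y z s1 s2 s3 \<and>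
        geodesic G S id s1 \<and> geodesic G S id s2 \<and> geodesic G S id s3 \<longrightarrow>
        thin G S id s1 s2 s3 \<delta>))"

end

theory Submission
  imports Defs
begin

text \<open>
  Repeated halving shows that an \<open>R\<close>-path between points at distance \<open>n\<close> stays within about
  \<open>2n/75\<close> of every geodesic, and by connectedness a geodesic stays within about \<open>4n/75\<close> of the
  \<open>R\<close>-path. So geodesic triangles are thin up to a small linear error, and this error improves
  itself: let \<open>D\<close> be the largest thinness of geodesic triangles of norm at most \<open>n\<close>, attained at a
  point \<open>p\<close> of a side. Using \<open>D\<close>-thinness only, \<open>p\<close> is enclosed in a hexagon of diameter \<open>O(D)\<close>
  with three sides on the given triangle, and the other three sides are also far from \<open>p\<close>. The
  linear estimate applied to this hexagon brings \<open>p\<close> within \<open>35D/75 + O(1)\<close> of the other five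
  sides. As \<open>35/75 < 1/2\<close>, this bounds \<open>D\<close> independently of \<open>n\<close>.
\<close>

section \<open>Segments and discrete connectedness in a pseudometric\<close>

text \<open>A discrete intermediate value argument, by induction on the length: if \<open>R\<close>
  already holds one step before the end, the shorter chain suffices; otherwise the last step is the
  switch.\<close>

lemma chain_switch:
  fixes n :: nat
  assumes "Q 0" "R n" "\<And>i. i \<le> n \<Longrightarrow> Q i \<or> R i"
  shows "\<exists>i\<le>n. \<exists>j\<le>n. Q i \<and> R j \<and> (j = i \<or> j = Suc i)"
  using assms
proof (induction n)
  case 0
  then show ?case by auto
next
  case (Suc n)
  show ?case
  proof (cases "R n")
    case True
    then obtain i j where "i \<le> n" "j \<le> n" "Q i" "R j" "j = i \<or> j = Suc i"
      using Suc.IH Suc.prems(1,3) by (metis le_SucI)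
    then show ?thesis by (intro exI[of _ i] conjI exI[of _ j]) auto
  next
    case False
    then have "Q n" using Suc.prems(3)[of n] by simp
    then show ?thesis using Suc.prems(2) by (metis le_SucI order_refl)
  qed
qed

locale pseudometric =
  fixes d :: "'g \<Rightarrow> 'g \<Rightarrow> nat"
  assumes d_refl [simp]: "d x x = 0"
    and d_sym: "d x y = d y x"
    and d_tri: "d x z \<le> d x y + d y z"
begin

text \<open>The endpoints of a segment are determined only up to distance 0.\<close>
definition seg :: "'g set \<Rightarrow> 'g \<Rightarrow> 'g \<Rightarrow> bool" where
  "seg A x y \<longleftrightarrow> (\<forall>u\<in>A. d x u + d u y = d x y) \<and>
     (\<forall>u\<in>A. \<forall>v\<in>A. d x u \<le> d x v \<longrightarrow> d x u + d u v = d x v) \<and>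
     (\<forall>t\<le>d x y. \<exists>u\<in>A. d x u = t)"

text \<open>Discrete connectedness from \<open>x\<close> to \<open>y\<close>, phrased by covers
  instead of a parametrised path. In this form it passes to supersets, so a union of two paths
  inherits it, and endpoints matter only up to distance 0.\<close>

definition linked :: "'g set \<Rightarrow> 'g \<Rightarrow> 'g \<Rightarrow> bool" where
  "linked A x y \<longleftrightarrow> (\<forall>U V. A \<subseteq> U \<union> V \<longrightarrow> (\<forall>u. d x u = 0 \<longrightarrow> u \<in> U) \<longrightarrow>
     (\<forall>v. d y v = 0 \<longrightarrow> v \<in> V) \<longrightarrow> (\<exists>a\<in>A \<inter> U. \<exists>b\<in>A \<inter> V. d a b \<le> 1))"

lemma linkedD:
  assumes "linked A x y" "\<And>a. a \<in> A \<Longrightarrow> Q a \<or> R a"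
    "\<And>u. d x u = 0 \<Longrightarrow> Q u" "\<And>u. d y u = 0 \<Longrightarrow> R u"
  obtains a b where "a \<in> A" "b \<in> A" "Q a" "R b" "d a b \<le> 1"
proof -
  have "\<exists>a\<in>A \<inter> Collect Q. \<exists>b\<in>A \<inter> Collect R. d a b \<le> 1"
    using assms(1)[unfolded linked_def, rule_format, of "Collect Q" "Collect R"] assms(2-) by auto
  then show thesis using that by blast
qed

lemma linked_mono:
  assumes "linked A x y" "A \<subseteq> B" "d x x' = 0" "d y y' = 0"
  shows "linked B x' y'"
  unfolding linked_def
proof (intro allI impI)
  fix U V assume cov: "B \<subseteq> U \<union> V" and x: "\<forall>u. d x' u = 0 \<longrightarrow> u \<in> U"
    and y: "\<forall>v. d y' v = 0 \<longrightarrow> v \<in> V"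
  have "u \<in> U" if "d x u = 0" for u
    using x d_tri[of x' u x] d_sym[of x x'] assms(3) that by simp
  moreover have "u \<in> V" if "d y u = 0" for u
    using y d_tri[of y' u y] d_sym[of y y'] assms(4) that by simp
  ultimately obtain a b where "a \<in> A" "b \<in> A" "a \<in> U" "b \<in> V" "d a b \<le> 1"
    using cov assms(2) by (rule_tac linkedD[OF assms(1), of "\<lambda>a. a \<in> U" "\<lambda>a. a \<in> V"]) auto
  then show "\<exists>a\<in>B \<inter> U. \<exists>b\<in>B \<inter> V. d a b \<le> 1" using assms(2) by blast
qed

lemma seg_sum: "seg A x y \<Longrightarrow> u \<in> A \<Longrightarrow> d x u + d u y = d x y"
  and seg_dist: "seg A x y \<Longrightarrow> u \<in> A \<Longrightarrow> v \<in> A \<Longrightarrow> d x u \<le> d x v \<Longrightarrow> d x u + d u v = d x v"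
  and seg_point: "seg A x y \<Longrightarrow> t \<le> d x y \<Longrightarrow> \<exists>u\<in>A. d x u = t"
  unfolding seg_def by blast+

lemma seg_sym:
  assumes "seg A x y"
  shows "seg A y x"
  unfolding seg_def
proof (intro conjI ballI allI impI)
  fix u assume u: "u \<in> A"
  show "d y u + d u x = d y x"
    using seg_sum[OF assms u] by (simp add: d_sym)
  fix v assume v: "v \<in> A" and le: "d y u \<le> d y v"
  have s: "d x u + d u y = d x y" "d x v + d v y = d x y"
    using seg_sum[OF assms] u v by auto
  have "d x v \<le> d x u" using s le d_sym[of y u] d_sym[of y v] by linarith
  from seg_dist[OF assms v u this]
  show "d y u + d u v = d y v" using s d_sym[of y u] d_sym[of y v] d_sym[of u v] by linarith
next
  fix t assume "t \<le> d y x"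
  then obtain u where u: "u \<in> A" "d x u = d x y - t"
    using seg_point[OF assms, of "d x y - t"] by auto
  have "d y u = t"
    using seg_sum[OF assms u(1)] u(2) \<open>t \<le> d y x\<close> d_sym[of y u] d_sym[of y x] by linarith
  then show "\<exists>u\<in>A. d y u = t" using u(1) by blast
qed

lemma seg_prefix:
  assumes "seg A x y" "c \<in> A"
  shows "seg {w\<in>A. d x w \<le> d x c} x c"
proof -
  have "\<exists>u\<in>{w\<in>A. d x w \<le> d x c}. d x u = t" if "t \<le> d x c" for t
    using seg_point[OF assms(1), of t] seg_sum[OF assms] that by auto
  then show ?thesis
    using assms seg_dist[OF assms(1)] unfolding seg_def by auto
qed

lemma seg_suffix:
  assumes "seg A x y" "c \<in> A"
  shows "seg {w\<in>A. d y w \<le> d y c} c y"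
  using seg_prefix[OF seg_sym[OF assms(1)] assms(2)] seg_sym by blast

lemma seg_initial: "seg A x y \<Longrightarrow> c \<in> A \<Longrightarrow> \<exists>A'\<subseteq>A. seg A' x c"
  and seg_final: "seg A x y \<Longrightarrow> c \<in> A \<Longrightarrow> \<exists>A'\<subseteq>A. seg A' c y"
  using seg_prefix seg_suffix by (metis (lifting) mem_Collect_eq subsetI)+

lemma seg_start: "seg A x y \<Longrightarrow> \<exists>u\<in>A. d x u = 0"
  and seg_end: "seg A x y \<Longrightarrow> \<exists>u\<in>A. d y u = 0"
  using seg_point seg_sym by blast+

text \<open>One point chosen at each distance from \<open>x\<close> gives a chain whose consecutive
  members are at distance 1.\<close>

lemma seg_linked:
  assumes "seg A x y"
  shows "linked A x y"
  unfolding linked_def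
proof (intro allI impI)
  fix U V assume cov: "A \<subseteq> U \<union> V" and x: "\<forall>u. d x u = 0 \<longrightarrow> u \<in> U"
    and y: "\<forall>v. d y v = 0 \<longrightarrow> v \<in> V"
  obtain c where c: "\<And>t. t \<le> d x y \<Longrightarrow> c t \<in> A \<and> d x (c t) = t"
    using seg_point[OF assms] by metis
  have "c 0 \<in> U" using c x by simp
  moreover have "c (d x y) \<in> V"
    using c[of "d x y"] y seg_sum[OF assms, of "c (d x y)"] d_sym by simp
  moreover have "c i \<in> U \<or> c i \<in> V" if "i \<le> d x y" for i
    using c[OF that] cov by auto
  ultimately obtain i j where ij: "i \<le> d x y" "j \<le> d x y" "c i \<in> U" "c j \<in> V" "j = i \<or> j = Suc i"
    using chain_switch[of "\<lambda>i. c i \<in> U" "\<lambda>i. c i \<in> V" "d x y"] by blast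
  have "d (c i) (c j) \<le> 1"
    using seg_dist[OF assms, of "c i" "c j"] c[of i] c[of j] ij by auto
  then show "\<exists>a\<in>A \<inter> U. \<exists>b\<in>A \<inter> V. d a b \<le> 1"
    using ij c by blast
qed

lemma d_tri_real: "real (d x z) \<le> real (d x y) + real (d y z)"
  using d_tri[of x z y] by linarith

end

section \<open>Comparing thin path systems with geodesics\<close>

text \<open>Abstracts what is used of the combing: \<open>P x y\<close> stands for the points of the
  chosen paths between \<open>x\<close> and \<open>y\<close>, \<open>P_thin\<close> for the width
  hypothesis, and \<open>P_small\<close> provides the base of the halving induction.\<close>

locale thin_paths = pseudometric d for d :: "'g \<Rightarrow> 'g \<Rightarrow> nat" +
  fixes P :: "'g \<Rightarrow> 'g \<Rightarrow> 'g set" and C :: real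
  assumes C_nonneg: "C \<ge> 0"
    and P_sym: "P x y = P y x"
    and P_linked: "linked (P x y) x y"
    and P_small: "d x y \<le> 1 \<Longrightarrow> a \<in> P x y \<Longrightarrow> real (d x a) \<le> C"
    and P_thin: "a \<in> P x y \<Longrightarrow>
      \<exists>b\<in>P x z \<union> P y z. real (d a b) \<le> real (max (d x y) (max (d y z) (d x z))) / 75 + C"
    and seg_ex: "\<exists>A. seg A x y"
begin

lemma P_triangle:
  assumes "a \<in> P x y" "real (d x y) \<le> N" "real (d y z) \<le> N" "real (d x z) \<le> N"
  obtains b where "b \<in> P x z \<or> b \<in> P y z" "real (d a b) \<le> N / 75 + C"
proof -
  obtain b where b: "b \<in> P x z \<union> P y z"
    "real (d a b) \<le> real (max (d x y) (max (d y z) (d x z))) / 75 + C"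
    using P_thin[OF assms(1)] by blast
  have "real (max (d x y) (max (d y z) (d x z))) \<le> N" using assms(2-) by simp
  then show thesis using b that[of b] by auto
qed

text \<open>Thinness is applied to the triangle over \<open>x\<close>, \<open>y\<close> and a
  midpoint \<open>c\<close> of the segment. The point moves to a path over one half, where the
  situation repeats; rounding in \<open>div 2\<close> accounts for the \<open>+ 1\<close>.\<close>

lemma P_halve:
  assumes "seg A x y" "a \<in> P x y" "2 \<le> d x y"
  obtains b u v A' where "seg A' u v" "A' \<subseteq> A" "b \<in> P u v" "d u v < d x y"
    "2 * d u v \<le> d x y + 1" "real (d a b) \<le> real (d x y) / 75 + C"
proof -
  obtain c where c: "c \<in> A" "d x c = d x y div 2"
    using seg_point[OF assms(1), of "d x y div 2"] by auto
  have cy: "d x c + d c y = d x y" using seg_sum[OF assms(1) c(1)] .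
  obtain b where b: "b \<in> P x c \<or> b \<in> P y c" "real (d a b) \<le> real (d x y) / 75 + C"
    using P_triangle[OF assms(2), of "real (d x y)" c] cy d_sym[of y c] by auto
  from b(1) show thesis
  proof
    assume "b \<in> P x c"
    moreover obtain A' where "A' \<subseteq> A" "seg A' x c" using seg_initial[OF assms(1) c(1)] by blast
    ultimately show thesis using that[of A' x c b] b c assms(3) by auto
  next
    assume "b \<in> P y c"
    then have "b \<in> P c y" using P_sym by blast
    moreover obtain A' where "A' \<subseteq> A" "seg A' c y" using seg_final[OF assms(1) c(1)] by blast
    moreover have "d c y < d x y" "2 * d c y \<le> d x y + 1" using cy c assms(3) by linarith+
    ultimately show thesis using that[of A' c y b] b by auto
  qed
qed

lemma P_near_seg_short:
  assumes "seg A x y" "a \<in> P x y" "d x y \<le> 1"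
  shows "\<exists>q\<in>A. real (d a q) \<le> C"
proof -
  obtain q where q: "q \<in> A" "d x q = 0" using seg_start[OF assms(1)] by blast
  have "real (d a q) \<le> C"
    using P_small[OF assms(3,2)] d_tri_real[of a q x] q d_sym[of a x] by simp
  then show ?thesis using q by blast
qed

text \<open>Halving with a generous slope, which swallows the additive \<open>C\<close> of every
  round as soon as the length is at least 2. It serves as the base case of the sharper
  estimate.\<close>

lemma P_near_seg_crude:
  "seg A x y \<Longrightarrow> a \<in> P x y \<Longrightarrow> \<exists>q\<in>A. real (d a q) \<le> 2 * (C + 1) * real (d x y) + C"
proof (induction "d x y" arbitrary: A x y a rule: less_induct)
  case less
  show ?case
  proof (cases "d x y \<le> 1")
    case True
    obtain q where q: "q \<in> A" "real (d a q) \<le> C"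
      using P_near_seg_short[OF less.prems True] by blast
    have "0 \<le> 2 * (C + 1) * real (d x y)" using C_nonneg by simp
    then have "real (d a q) \<le> 2 * (C + 1) * real (d x y) + C" using q(2) by linarith
    then show ?thesis using q(1) by blast
  next
    case False
    then have n2: "2 \<le> d x y" by simp
    obtain b u v A' where h: "seg A' u v" "A' \<subseteq> A" "b \<in> P u v" "d u v < d x y"
      "2 * d u v \<le> d x y + 1" "real (d a b) \<le> real (d x y) / 75 + C"
      by (rule P_halve[OF less.prems n2])
    obtain q where q: "q \<in> A'" "real (d b q) \<le> 2 * (C + 1) * real (d u v) + C"
      using less.hyps[OF h(4,1,3)] by blast
    have "2 * (C + 1) * real (d u v) = (C + 1) * real (2 * d u v)" by simp
    also have "\<dots> \<le> (C + 1) * (real (d x y) + 1)"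
      using h(5) C_nonneg by (intro mult_left_mono) linarith+
    finally have 1: "real (d b q) \<le> (C + 1) * (real (d x y) + 1) + C" using q(2) by linarith
    have 2: "C * 1 \<le> C * (real (d x y) - 1)"
      using n2 C_nonneg by (intro mult_left_mono) linarith+
    have "real (d a q) \<le> real (d x y) / 75 + C + (C + 1) * (real (d x y) + 1) + C"
      using d_tri_real[of a q b] h(6) 1 by linarith
    also have "\<dots> \<le> 2 * (C + 1) * real (d x y) + C"
      using 2 n2 by (simp add: algebra_simps)
    finally show ?thesis using q h by blast
  qed
qed

text \<open>The crude bound at length \<open>150 * (C + 1)\<close>, the threshold above which the
  sharper slope takes over.\<close>

definition \<beta> :: real where "\<beta> = 2 * (C + 1) * (150 * (C + 1)) + C"

lemma \<beta>_nonneg: "\<beta> \<ge> 0"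
  using C_nonneg by (simp add: \<beta>_def)

text \<open>Halving costs \<open>n/75 + C\<close>, so the slope 1/25 exceeds the limit slope 2/75 of the geometric
  series; the surplus absorbs the constants once \<open>n \<ge> 150 (C + 1)\<close>.\<close>
lemma P_near_seg:
  "seg A x y \<Longrightarrow> a \<in> P x y \<Longrightarrow> \<exists>q\<in>A. real (d a q) \<le> real (d x y) / 25 + \<beta>"
proof (induction "d x y" arbitrary: A x y a rule: less_induct)
  case less
  show ?case
  proof (cases "real (d x y) \<le> 150 * (C + 1)")
    case True
    then have "2 * (C + 1) * real (d x y) + C \<le> \<beta>"
      unfolding \<beta>_def using C_nonneg by (intro add_right_mono mult_left_mono) auto
    then show ?thesis using P_near_seg_crude[OF less.prems] by force
  next
    case False
    then have n2: "2 \<le> d x y" using C_nonneg by simp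
    obtain b u v A' where h: "seg A' u v" "A' \<subseteq> A" "b \<in> P u v" "d u v < d x y"
      "2 * d u v \<le> d x y + 1" "real (d a b) \<le> real (d x y) / 75 + C"
      by (rule P_halve[OF less.prems n2])
    obtain q where q: "q \<in> A'" "real (d b q) \<le> real (d u v) / 25 + \<beta>"
      using less.hyps[OF h(4,1,3)] by blast
    have "2 * real (d u v) \<le> real (d x y) + 1" using h(5) by linarith
    then have "real (d a q) \<le> real (d x y) / 25 + \<beta>"
      using d_tri_real[of a q b] h(6) q(2) False by argo
    then show ?thesis using q h by blast
  qed
qed

text \<open>Each point of \<open>P x y\<close> is near the part of the segment before
  \<open>g\<close> or the part after it. By connectedness two adjacent points \<open>a\<close>,
  \<open>b\<close> have nearby points \<open>q\<close>, \<open>r\<close> on opposite sides of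
  \<open>g\<close>; as \<open>q\<close> and \<open>r\<close> are close to each other,
  \<open>g\<close> is squeezed between them.\<close>

lemma seg_near_P:
  assumes "seg A x y" "g \<in> A"
  obtains a where "a \<in> P x y" "real (d g a) \<le> 2 * real (d x y) / 25 + 2 * \<beta> + 1"
proof -
  let ?f = "real (d x y) / 25 + \<beta>"
  let ?Q = "\<lambda>a. \<exists>q\<in>A. d x q \<le> d x g \<and> real (d a q) \<le> ?f"
  let ?R = "\<lambda>a. \<exists>q\<in>A. d x g \<le> d x q \<and> real (d a q) \<le> ?f"
  have f: "?f \<ge> 0" using \<beta>_nonneg by simp
  have "?Q a \<or> ?R a" if "a \<in> P x y" for a
    using P_near_seg[OF assms(1) that] by (meson nle_le)
  moreover have "?Q u" if "d x u = 0" for u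
  proof -
    obtain q where q: "q \<in> A" "d x q = 0" using seg_start[OF assms(1)] by blast
    have "d u q = 0" using d_tri[of u q x] d_sym[of u x] that q by simp
    then show ?thesis using q f by (intro bexI[of _ q]) auto
  qed
  moreover have "?R u" if "d y u = 0" for u
  proof -
    obtain q where q: "q \<in> A" "d y q = 0" using seg_end[OF assms(1)] by blast
    have "d u q = 0" using d_tri[of u q y] d_sym[of u y] that q by simp
    moreover have "d x g \<le> d x q"
      using seg_sum[OF assms] seg_sum[OF assms(1) q(1)] q(2) d_sym[of q y] by linarith
    ultimately show ?thesis using q f by (intro bexI[of _ q]) auto
  qed
  ultimately obtain a b where ab: "a \<in> P x y" "b \<in> P x y" "?Q a" "?R b" "d a b \<le> 1"
    by (rule linkedD[OF P_linked[of x y], of ?Q ?R])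
  obtain q where q: "q \<in> A" "d x q \<le> d x g" "real (d a q) \<le> ?f" using ab(3) by blast
  obtain r where r: "r \<in> A" "d x g \<le> d x r" "real (d b r) \<le> ?f" using ab(4) by blast
  have qg: "d x q + d q g = d x g" using seg_dist[OF assms(1) q(1) assms(2) q(2)] .
  have gr: "d x g + d g r = d x r" using seg_dist[OF assms(1) assms(2) r(1,2)] .
  have qr: "d x q + d q r = d x r" using seg_dist[OF assms(1) q(1) r(1)] q(2) r(2) by simp
  have "d q g + d g r = d q r" using qg gr qr by linarith
  then have qgr: "real (d q g) + real (d g r) = real (d q r)" by linarith
  have sum: "real (d q g) + real (d g r) \<le> 2 * ?f + 1"
    using d_tri_real[of q r a] d_tri_real[of a r b] d_sym[of q a] q(3) r(3) ab(5)
    unfolding qgr by simp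
  \<comment> \<open>The two distances add up to at most \<open>2 * ?f + 1\<close>, so either the
    first is at most \<open>?f + 1\<close> or the second is below \<open>?f\<close>.\<close>
  show thesis
  proof (cases "real (d q g) \<le> ?f + 1")
    case True
    have "real (d g a) \<le> 2 * real (d x y) / 25 + 2 * \<beta> + 1"
      using d_tri_real[of g a q] d_sym[of g q] d_sym[of q a] True q(3) by linarith
    then show thesis using that ab by blast
  next
    case False
    have "real (d g b) \<le> 2 * real (d x y) / 25 + 2 * \<beta> + 1"
      using d_tri_real[of g b r] False sum r(3) unfolding d_sym[of r b] by argo
    then show thesis using that ab by blast
  qed
qed

text \<open>The slope 10/75 is 6/75 for moving from the segment to \<open>P x y\<close>, 1/75 for
  crossing the triangle of \<open>P\<close>-paths, and 3/75 for returning to a segment.\<close>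

lemma seg_thin_linear:
  assumes "seg A x y" "seg B y z" "seg E z x" "a \<in> A"
    and N: "d x y \<le> N" "d y z \<le> N" "d z x \<le> N"
  obtains b where "b \<in> B \<union> E" "real (d a b) \<le> 10 * real N / 75 + (3 * \<beta> + C + 1)"
proof -
  obtain a0 where a0: "a0 \<in> P x y" "real (d a a0) \<le> 2 * real (d x y) / 25 + 2 * \<beta> + 1"
    using seg_near_P[OF assms(1,4)] .
  obtain a1 where a1: "a1 \<in> P x z \<or> a1 \<in> P y z" "real (d a0 a1) \<le> real N / 75 + C"
    using P_triangle[OF a0(1), of "real N" z] N d_sym[of x z] by auto
  have "\<exists>q\<in>B \<union> E. real (d a1 q) \<le> real N / 25 + \<beta>"
    using a1(1)
  proof
    assume "a1 \<in> P x z"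
    then have "a1 \<in> P z x" using P_sym by blast
    from P_near_seg[OF assms(3) this] obtain q where "q \<in> E" "real (d a1 q) \<le> real (d z x) / 25 + \<beta>"
      by blast
    then show ?thesis using N(3) by (intro bexI[of _ q]) auto
  next
    assume "a1 \<in> P y z"
    from P_near_seg[OF assms(2) this] obtain q where "q \<in> B" "real (d a1 q) \<le> real (d y z) / 25 + \<beta>"
      by blast
    then show ?thesis using N(2) by (intro bexI[of _ q]) auto
  qed
  then obtain q where q: "q \<in> B \<union> E" "real (d a1 q) \<le> real N / 25 + \<beta>" by blast
  have "real (d a q) \<le> 10 * real N / 75 + (3 * \<beta> + C + 1)"
    using d_tri_real[of a q a0] d_tri_real[of a0 q a1] a0(2) a1(2) q(2) N(1) by linarith
  then show thesis using that q by blast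
qed

section \<open>Self-improvement of the thinness of geodesic triangles\<close>

text \<open>Bounding the norm by \<open>n\<close> guarantees that a least \<open>D\<close> exists.
  Speaking of the side \<open>A\<close> alone suffices, because the vertices can be permuted
  cyclically.\<close>

definition thin_upto :: "nat \<Rightarrow> nat \<Rightarrow> bool" where
  "thin_upto n D \<longleftrightarrow> (\<forall>x y z A B E. seg A x y \<longrightarrow> seg B y z \<longrightarrow> seg E z x \<longrightarrow>
     d x y \<le> n \<longrightarrow> d y z \<le> n \<longrightarrow> d z x \<le> n \<longrightarrow> (\<forall>a\<in>A. \<exists>b\<in>B \<union> E. d a b \<le> D))"

lemma thin_uptoD:
  assumes "thin_upto n D" "seg A x y" "seg B y z" "seg E z x"
    "d x y \<le> n" "d y z \<le> n" "d z x \<le> n" "a \<in> A"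
  shows "\<exists>b\<in>B \<union> E. d a b \<le> D"
  using assms unfolding thin_upto_def by blast

text \<open>Small multiples of this constant dominate the additive errors accumulated in the walk
  through the hexagon.\<close>

definition K0 :: real where "K0 = 3 * \<beta> + 4 * C + 2"

text \<open>The hexagon is \<open>x' y' y'' z'' z' x''\<close>, with \<open>p\<close> the midpoint of \<open>x' y'\<close>, and is filled
  by four triangles of \<open>P\<close>-paths. A point of \<open>z' z''\<close> is \<open>D/2\<close>-close to an endpoint, hence
  \<open>D/2\<close>-far from \<open>p\<close>. For \<open>x' x''\<close> and \<open>y' y''\<close> the distance from \<open>p\<close> may be only \<open>D/4\<close>, but
  these sides are met after at most two triangles.\<close>
lemma max_thinness_bounded:
  assumes thin: "thin_upto n D"
    and A: "seg A x y" and B: "seg B y z" and E: "seg E z x"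
    and n: "d x y \<le> n" "d y z \<le> n" "d z x \<le> n"
    and p: "p \<in> A" and far: "\<And>b. b \<in> B \<union> E \<Longrightarrow> D \<le> d p b"
  shows "real D \<le> 100 * (K0 + 1)"
proof (rule ccontr)
  assume "\<not> ?thesis"
  then have big: "real D > 100 * (K0 + 1)" by simp
  have bc: "\<beta> \<ge> 0" "C \<ge> 0" using \<beta>_nonneg C_nonneg by auto
  \<comment> \<open>The linear estimate makes \<open>n\<close> at least \<open>3 * D\<close>. Hence
    \<open>D\<close>-thinness may later be used for a triangle with a new side of length up to
    \<open>3 * D\<close>.\<close>
  obtain b0 where b0: "b0 \<in> B \<union> E" "real (d p b0) \<le> 10 * real n / 75 + (3 * \<beta> + C + 1)"
    using seg_thin_linear[OF A B E p n] .
  have "real D \<le> real (d p b0)" using far[OF b0(1)] by simp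
  then have "3 * real D \<le> real n" using b0(2) big bc unfolding K0_def by argo
  then have n3: "3 * D \<le> n" by linarith
  \<comment> \<open>The ends of \<open>A\<close> lie on \<open>E\<close> and \<open>B\<close> up to
    distance 0, so \<open>p\<close> is at least \<open>D\<close> away from both. This leaves room on
    \<open>A\<close> for \<open>x'\<close> and \<open>y'\<close>.\<close>
  obtain u where u: "u \<in> E" "d x u = 0" using seg_end[OF E] by blast
  obtain v where v: "v \<in> B" "d y v = 0" using seg_start[OF B] by blast
  have px: "D \<le> d x p"
    using far[of u] d_tri[of p u x] d_sym[of p x] u by auto
  have py: "D \<le> d p y"
    using far[of v] d_tri[of p v y] v by auto
  have pxy: "d x p + d p y = d x y" using seg_sum[OF A p] .
  define K where "K = D div 2"
  have K: "2 * K \<le> D" "D \<le> 2 * K + 1" unfolding K_def by linarith+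
  obtain x' where x': "x' \<in> A" "d x x' = d x p - K"
    using seg_point[OF A, of "d x p - K"] pxy by (metis diff_le_self le_add1 order_trans)
  obtain y' where y': "y' \<in> A" "d x y' = d x p + K"
  proof -
    have "d x p + K \<le> d x y" using pxy py K by linarith
    then show thesis using seg_point[OF A] that by blast
  qed
  have px': "d x' p = K" using seg_dist[OF A x'(1) p] x' px K by linarith
  have py': "d p y' = K" using seg_dist[OF A p y'(1)] y' by linarith
  have xy': "d x' y' \<le> D" and xy'_ge: "K \<le> d x' y'"
    using seg_dist[OF A x'(1) y'(1)] x' y' px K by linarith+
  obtain A2 where A2: "seg A2 x' y'" "p \<in> A2"
  proof -
    have yd: "d y y' \<le> d y x'" "d y p \<le> d y x'"
      using seg_sum[OF A x'(1)] seg_sum[OF A y'(1)] pxy x' y' d_sym[of y] by auto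
    have "seg {w\<in>A. d y w \<le> d y x'} x' y" using seg_suffix[OF A x'(1)] .
    from seg_prefix[OF this, of y'] that show thesis
      using yd y'(1) p px' xy'_ge by auto
  qed
  obtain x'' where x'': "x'' \<in> B \<union> E" "d x' x'' \<le> D"
    using thin_uptoD[OF thin A B E n x'(1)] by blast
  obtain y'' where y'': "y'' \<in> B \<union> E" "d y' y'' \<le> D"
    using thin_uptoD[OF thin A B E n y'(1)] by blast
  obtain J where J: "seg J x'' y''" using seg_ex by blast
  \<comment> \<open>Both \<open>B\<close> and \<open>E\<close> end at \<open>z\<close>, so
    \<open>x''\<close> and \<open>y''\<close> are joined to \<open>z\<close> inside
    \<open>B \<union> E\<close>, whichever of the two sides they lie on.\<close>
  have side: "\<exists>S\<subseteq>B \<union> E. seg S z w \<and> d z w \<le> n" if "w \<in> B \<union> E" for w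
    using that
  proof
    assume w: "w \<in> B"
    obtain S where "S \<subseteq> B" "seg S w z" using seg_final[OF B w] by blast
    moreover have "d z w \<le> n" using seg_sum[OF B w] n(2) d_sym[of z w] by linarith
    ultimately show ?thesis using seg_sym by blast
  next
    assume w: "w \<in> E"
    obtain S where "S \<subseteq> E" "seg S z w" using seg_initial[OF E w] by blast
    moreover have "d z w \<le> n" using seg_sum[OF E w] n(3) by linarith
    ultimately show ?thesis by blast
  qed
  obtain B1 where B1: "B1 \<subseteq> B \<union> E" "seg B1 z x''" "d z x'' \<le> n"
    using side[OF x''(1)] by blast
  obtain B2 where B2: "B2 \<subseteq> B \<union> E" "seg B2 z y''" "d z y'' \<le> n"
    using side[OF y''(1)] by blast
  have x'y'': "d x' y'' \<le> 2 * D" using d_tri[of x' y'' y'] xy' y'' by linarith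
  have x''y'': "d x'' y'' \<le> 3 * D"
    using d_tri[of x'' y'' x'] d_sym[of x'' x'] x'' x'y'' by linarith
  \<comment> \<open>In the geodesic triangle \<open>z x'' y''\<close>, points of \<open>B1\<close>
    are close to \<open>B2\<close> near \<open>z\<close> and close to \<open>J\<close> near
    \<open>x''\<close>. At the switch lies \<open>z'\<close>: it is within \<open>D\<close> of some
    \<open>z''\<close> on \<open>B2\<close> and within \<open>D + 1\<close> of \<open>J\<close>,
    which bounds its distance to \<open>x''\<close> and \<open>y''\<close>.\<close>
  have tri: "\<exists>b\<in>J \<union> B2. d a b \<le> D" if "a \<in> B1" for a
    using thin_uptoD[OF thin B1(2) J seg_sym[OF B2(2)] B1(3) _ _ that] x''y'' n3 B2(3)
      d_sym[of z y''] by auto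
  have "(\<exists>b\<in>B2. d a b \<le> D) \<or> (\<exists>b\<in>J. d a b \<le> D)" if "a \<in> B1" for a
    using tri[OF that] by blast
  moreover have "\<exists>b\<in>B2. d a b \<le> D" if "d z a = 0" for a
  proof -
    obtain b where "b \<in> B2" "d z b = 0" using seg_start[OF B2(2)] by blast
    then show ?thesis using d_tri[of a b z] d_sym[of a z] that by (intro bexI[of _ b]) auto
  qed
  moreover have "\<exists>b\<in>J. d a b \<le> D" if "d x'' a = 0" for a
  proof -
    obtain b where "b \<in> J" "d x'' b = 0" using seg_start[OF J] by blast
    then show ?thesis using d_tri[of a b x''] d_sym[of a x''] that by (intro bexI[of _ b]) auto
  qed
  ultimately obtain z' w where zw: "z' \<in> B1" "w \<in> B1" "\<exists>b\<in>B2. d z' b \<le> D"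
      "\<exists>b\<in>J. d w b \<le> D" "d z' w \<le> 1"
    by (rule linkedD[OF seg_linked[OF B1(2)],
          of "\<lambda>a. \<exists>b\<in>B2. d a b \<le> D" "\<lambda>a. \<exists>b\<in>J. d a b \<le> D"])
  obtain z'' where z'': "z'' \<in> B2" "d z' z'' \<le> D" using zw by blast
  obtain q where q: "q \<in> J" "d w q \<le> D" using zw by blast
  have z'q: "d z' q \<le> D + 1" using d_tri[of z' q w] zw q by linarith
  have qs: "d x'' q + d q y'' \<le> 3 * D" using seg_sum[OF J q(1)] x''y'' by linarith
  have x''z': "d x'' z' \<le> 4 * D + 1" using d_tri[of x'' z' q] d_sym[of q z'] z'q qs by linarith
  have y''z': "d y'' z' \<le> 4 * D + 1"
    using d_tri[of y'' z' q] d_sym[of q z'] d_sym[of y'' q] z'q qs by linarith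
  have y''z'': "d y'' z'' \<le> 5 * D + 1" using d_tri[of y'' z'' z'] y''z' z'' by linarith
  have K0: "C \<le> K0" "0 \<le> K0" using bc unfolding K0_def by linarith+
  note farp = far[OF x''(1)] far[OF y''(1)] far[of z'] far[of z'']
  have farz: "D \<le> d p z'" "D \<le> d p z''" using farp zw z'' B1 B2 by auto

  \<comment> \<open>Excludes the legs \<open>x' x''\<close> and \<open>y' y''\<close>: one end is at
    distance \<open>K\<close> from \<open>p\<close>, the other at least \<open>D\<close>, and the
    length is at most \<open>D\<close>, so every point of the leg is at least
    \<open>(D - 1) / 4\<close> from \<open>p\<close>. This contradicts the slope 14/75.\<close>
  have leg_far: False
    if s: "d p s = K" and st: "d s t \<le> D" and t: "D \<le> d p t" and c: "c \<in> P s t"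
      and pc: "real (d p c) \<le> 11 * real D / 75 + 2 * K0" for s t c
  proof -
    obtain L where L: "seg L s t" using seg_ex by blast
    obtain r where r: "r \<in> L" "real (d c r) \<le> real (d s t) / 25 + \<beta>"
      using P_near_seg[OF L c] by blast
    have "real (d s t) \<le> real D" using st by simp
    then have "real (d p r) \<le> 14 * real D / 75 + 3 * K0"
      using d_tri_real[of p r c] pc r(2) bc unfolding K0_def by argo
    moreover have "D \<le> 4 * d p r + 1"
      using d_tri[of p s r] d_tri[of p t r] d_sym[of r s] seg_sum[OF L r(1)] s st t K by linarith
    then have "real D \<le> 4 * real (d p r) + 1" by linarith
    ultimately show False using big K0 by argo
  qed

  \<comment> \<open>From here \<open>p\<close> is pushed through the four triangles. In units of
    \<open>D / 75\<close> its displacement is 6 after reaching \<open>P x' y'\<close>, then 8, 11,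
    15 and 20, as triangles of norm at most \<open>2 * D\<close>, \<open>3 * D\<close>,
    \<open>4 * D + 1\<close> and \<open>5 * D + 1\<close> are crossed.\<close>
  obtain p' where p': "p' \<in> P x' y'" "real (d p p') \<le> 2 * real D / 25 + 2 * \<beta> + 1"
  proof -
    obtain a where "a \<in> P x' y'" "real (d p a) \<le> 2 * real (d x' y') / 25 + 2 * \<beta> + 1"
      by (rule seg_near_P[OF A2])
    then show thesis using that[of a] xy' by fastforce
  qed
  obtain p1 where p1: "p1 \<in> P x' y'' \<or> p1 \<in> P y' y''" "real (d p' p1) \<le> (2 * real D) / 75 + C"
    using P_triangle[OF p'(1), of "2 * real D" y''] xy' y'' x'y'' by auto
  have pp1: "real (d p p1) \<le> 8 * real D / 75 + K0"
    using d_tri_real[of p p1 p'] p'(2) p1(2) bc unfolding K0_def by argo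
  have "real (d p p1) \<le> 11 * real D / 75 + 2 * K0" using pp1 K0 by simp
  then have "p1 \<notin> P y' y''" using leg_far[OF py' y''(2) farp(2)] by blast
  then have p1': "p1 \<in> P x' y''" using p1 by blast
  obtain p2 where p2: "p2 \<in> P x' x'' \<or> p2 \<in> P y'' x''" "real (d p1 p2) \<le> (3 * real D) / 75 + C"
    using P_triangle[OF p1', of "3 * real D" x''] x'y'' x'' x''y'' d_sym[of x'' y''] by auto
  have pp2: "real (d p p2) \<le> 11 * real D / 75 + K0 + C"
    using d_tri_real[of p p2 p1] pp1 p2(2) bc by argo
  have "d p x' = K" using px' d_sym[of p x'] by simp
  moreover have "real (d p p2) \<le> 11 * real D / 75 + 2 * K0" using pp2 K0 by simp
  ultimately have "p2 \<notin> P x' x''" using leg_far[OF _ x''(2) farp(1)] by blast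
  then have p2': "p2 \<in> P x'' y''" using p2 P_sym by blast
  \<comment> \<open>Excludes the sides that run along \<open>B \<union> E\<close>: their points are
    at least \<open>D\<close> from \<open>p\<close>, while the total slope is only 20/75 +
    15/75.\<close>
  have near: False
    if pc: "real (d p c) \<le> 20 * real D / 75 + K0 + 3 * C + 1" and c: "c \<in> P s t"
      and L: "seg L s t" and LS: "L \<subseteq> B \<union> E" and st: "d s t \<le> 5 * D + 1" for c s t L
  proof -
    obtain r where r: "r \<in> L" "real (d c r) \<le> real (d s t) / 25 + \<beta>"
      using P_near_seg[OF L c] by blast
    have "real D \<le> real (d p r)" using far LS r(1) by auto
    moreover have "real (d s t) \<le> 5 * real D + 1" using st by linarith
    ultimately show False
      using d_tri_real[of p r c] r(2) pc big bc unfolding K0_def by argo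
  qed
  obtain L1 where L1: "L1 \<subseteq> B1" "seg L1 z' x''" using seg_final[OF B1(2) zw(1)] by blast
  obtain L2 where L2: "L2 \<subseteq> B2" "seg L2 z'' y''" using seg_final[OF B2(2) z''(1)] by blast
  obtain p3 where p3: "p3 \<in> P x'' z' \<or> p3 \<in> P y'' z'"
    "real (d p2 p3) \<le> (4 * real D + 1) / 75 + C"
    using P_triangle[OF p2', of "4 * real D + 1" z'] x''y'' x''z' y''z' by auto
  have pp3: "real (d p p3) \<le> 15 * real D / 75 + K0 + 2 * C + 1 / 2"
    using d_tri_real[of p p3 p2] pp2 p3(2) bc by argo
  have "real (d p p3) \<le> 20 * real D / 75 + K0 + 3 * C + 1" using pp3 bc by simp
  moreover have "L1 \<subseteq> B \<union> E" "d x'' z' \<le> 5 * D + 1" using L1(1) B1(1) x''z' by auto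
  ultimately have "p3 \<notin> P x'' z'" using near[OF _ _ seg_sym[OF L1(2)]] by blast
  then have p3': "p3 \<in> P y'' z'" using p3 by blast
  obtain p4 where p4: "p4 \<in> P y'' z'' \<or> p4 \<in> P z' z''"
    "real (d p3 p4) \<le> (5 * real D + 1) / 75 + C"
    using P_triangle[OF p3', of "5 * real D + 1" z''] y''z' y''z'' z'' by auto
  have pp4: "real (d p p4) \<le> 20 * real D / 75 + K0 + 3 * C + 1"
    using d_tri_real[of p p4 p3] pp3 p4(2) bc by argo
  have "p4 \<notin> P y'' z''"
    using near[OF pp4 _ seg_sym[OF L2(2)] _ y''z''] L2(1) B2(1) by blast
  then have p4': "p4 \<in> P z' z''" using p4 by blast
  \<comment> \<open>Only \<open>z' z''\<close> remains. Its ends are at least \<open>D\<close> from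
    \<open>p\<close> and its length is at most \<open>D\<close>, so its points are at least
    \<open>D / 2\<close> away, against the slope 23/75.\<close>
  obtain L where L: "seg L z' z''" using seg_ex by blast
  obtain r where r: "r \<in> L" "real (d p4 r) \<le> real (d z' z'') / 25 + \<beta>"
    using P_near_seg[OF L p4'] by blast
  have "real (d z' z'') \<le> real D" using z''(2) by simp
  then have "real (d p r) \<le> 23 * real D / 75 + 3 * K0"
    using d_tri_real[of p r p4] pp4 r(2) bc unfolding K0_def by argo
  moreover have "D \<le> 2 * d p r"
    using d_tri[of p z' r] d_tri[of p z'' r] d_sym[of r z'] seg_sum[OF L r(1)] farz z''(2) by linarith
  then have "real D \<le> 2 * real (d p r)" by linarith
  ultimately show False using big K0 by argo
qed

text \<open>For each \<open>n\<close> take the least admissible \<open>D\<close>. Minimality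
  supplies a triangle and a point at distance at least \<open>D\<close> from the other two sides,
  which is the situation of \<open>max_thinness_bounded\<close>; the resulting bound does not
  involve \<open>n\<close>.\<close>

theorem uniformly_thin: "\<exists>M. \<forall>n. thin_upto n M"
proof -
  define M where "M = nat \<lceil>100 * (K0 + 1)\<rceil>"
  have "thin_upto n M" for n
  proof -
    \<comment> \<open>The value \<open>n\<close> is admissible, because \<open>x\<close> lies on
      \<open>E\<close> up to distance 0 and no point of \<open>A\<close> is further than
      \<open>n\<close> from it.\<close>
    have "\<exists>b\<in>B \<union> E. d a b \<le> n"
      if A: "seg A x y" and E: "seg E z x" and n: "d x y \<le> n" and a: "a \<in> A"
      for x y z a A B E
    proof -
      obtain b where "b \<in> E" "d x b = 0" using seg_end[OF E] by blast
      moreover have "d x a \<le> n" using seg_sum[OF A a] n by linarith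
      ultimately show ?thesis using d_tri[of a b x] d_sym[of a x] by (intro bexI[of _ b]) auto
    qed
    then have "thin_upto n n" unfolding thin_upto_def by blast
    define D where "D = (LEAST D. thin_upto n D)"
    have D: "thin_upto n D" unfolding D_def using \<open>thin_upto n n\<close> by (rule LeastI)
    have "D \<le> M"
    proof (cases D)
      case (Suc D')
      then have "\<not> thin_upto n D'" using not_less_Least[of D' "thin_upto n"] D_def by auto
      then obtain x y z A B E a where h: "seg A x y" "seg B y z" "seg E z x" "d x y \<le> n" "d y z \<le> n"
        "d z x \<le> n" "a \<in> A" and far: "\<forall>b\<in>B \<union> E. \<not> d a b \<le> D'"
        unfolding thin_upto_def by blast
      have "D \<le> d a b" if "b \<in> B \<union> E" for b using far that Suc by force
      from max_thinness_bounded[OF D h this] show ?thesis unfolding M_def by linarith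
    qed simp
    then show ?thesis using D unfolding thin_upto_def by (meson le_trans)
  qed
  then show ?thesis by blast
qed

end

section \<open>Evaluation of words and the width of a triangle\<close>

lemma weval_Nil [simp]: "weval G e [] = \<one>\<^bsub>G\<^esub>"
  and weval_Cons [simp]: "weval G e (a # w) = e a \<otimes>\<^bsub>G\<^esub> weval G e w"
  by (simp_all add: weval_def)

text \<open>Hyperbolicity is defined with generators that are group elements, evaluated by
  \<open>id\<close>. This and the next facts transport words over \<open>S\<close> to words over the
  image of \<open>S\<close> under \<open>e\<close>.\<close>

lemma weval_map: "weval G id (map e w) = weval G e w"
  by (induction w) simp_all

lemma lists_image_map: "w \<in> lists (e ` S) \<longleftrightarrow> (\<exists>v\<in>lists S. w = map e v)"
  by (simp add: lists_image image_iff)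

lemma wdist_image: "wdist G (e ` S) id g h = wdist G S e g h"
  unfolding wdist_def lists_image by (simp add: weval_map)

lemma path_pts_map: "path_pts G id (g, map e w) = path_pts G e (g, w)"
  by (simp add: path_pts_def take_map weval_map)

lemma path_pts_image: "path_pts G e p = (\<lambda>i. fst p \<otimes>\<^bsub>G\<^esub> weval G e (take i (snd p))) ` {..length (snd p)}"
  by (auto simp: path_pts_def)

text \<open>The width is a \<open>LEAST\<close>, so some admissible number must exist: paths have
  finitely many points and at least one, hence the maximum of all distances between them
  works.\<close>

lemma thin_width: "thin G S e s1 s2 s3 (real (width G S e s1 s2 s3))"
proof -
  let ?F = "path_pts G e s1 \<union> path_pts G e s2 \<union> path_pts G e s3"
  have "finite ((\<lambda>(p, q). wdist G S e p q) ` (?F \<times> ?F))"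
    by (simp add: path_pts_image)
  then obtain n where "\<forall>k\<in>(\<lambda>(p, q). wdist G S e p q) ` (?F \<times> ?F). k \<le> n"
    using finite_nat_set_iff_bounded_le by blast
  then have n: "\<And>p q. p \<in> ?F \<Longrightarrow> q \<in> ?F \<Longrightarrow> wdist G S e p q \<le> n" by auto
  have ne: "path_pts G e s \<noteq> {}" for s :: "'a \<times> 'c list"
    by (simp add: path_pts_image)
  obtain q1 q2 where q: "q1 \<in> path_pts G e s1" "q2 \<in> path_pts G e s2"
    using ne by blast
  have "thin G S e s1 s2 s3 (real n)"
    unfolding thin_def
  proof (intro conjI ballI)
    fix p assume "p \<in> path_pts G e s1"
    then show "\<exists>q\<in>path_pts G e s2 \<union> path_pts G e s3. real (wdist G S e p q) \<le> real n"
      using n[of p q2] q by (intro bexI[of _ q2]) auto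
  next
    fix p assume "p \<in> path_pts G e s2"
    then show "\<exists>q\<in>path_pts G e s1 \<union> path_pts G e s3. real (wdist G S e p q) \<le> real n"
      using n[of p q1] q by (intro bexI[of _ q1]) auto
  next
    fix p assume "p \<in> path_pts G e s3"
    then show "\<exists>q\<in>path_pts G e s1 \<union> path_pts G e s2. real (wdist G S e p q) \<le> real n"
      using n[of p q1] q by (intro bexI[of _ q1]) auto
  qed
  then show ?thesis unfolding width_def by (rule LeastI)
qed

section \<open>The word metric of a group with chosen generators\<close>

locale generated_group = group G for G :: "('g, 'b) monoid_scheme" (structure) +
  fixes S :: "'a set" and iv :: "'a \<Rightarrow> 'a" and e :: "'a \<Rightarrow> 'g"
  assumes gens: "gen_choice G S iv e"
begin

lemma finite_S: "finite S"
  and iv_closed: "a \<in> S \<Longrightarrow> iv a \<in> S"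
  and e_closed [simp]: "a \<in> S \<Longrightarrow> e a \<in> carrier G"
  and e_iv: "a \<in> S \<Longrightarrow> e (iv a) = inv e a"
  and word_exists: "g \<in> carrier G \<Longrightarrow> \<exists>w\<in>lists S. weval G e w = g"
  using gens unfolding gen_choice_def by blast+

lemma weval_closed [simp]: "w \<in> lists S \<Longrightarrow> weval G e w \<in> carrier G"
  by (induction w) auto

lemma weval_append:
  "v \<in> lists S \<Longrightarrow> w \<in> lists S \<Longrightarrow> weval G e (v @ w) = weval G e v \<otimes> weval G e w"
  by (induction v) (auto simp: m_assoc)

lemma weval_inverse_word: "w \<in> lists S \<Longrightarrow> weval G e (rev (map iv w)) = inv (weval G e w)"
proof (induction w)
  case (Cons a w)
  have "rev (map iv w) \<in> lists S" "[iv a] \<in> lists S" using Cons.prems iv_closed by auto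
  then show ?case
    using Cons by (auto simp: weval_append e_iv inv_mult_group)
qed simp

abbreviation wd :: "'g \<Rightarrow> 'g \<Rightarrow> nat" where "wd \<equiv> wdist G S e"

lemma wd_le: "w \<in> lists S \<Longrightarrow> x \<otimes> weval G e w = y \<Longrightarrow> wd x y \<le> length w"
  unfolding wdist_def by (rule Least_le) blast

lemma wd_attained:
  assumes "x \<in> carrier G" "y \<in> carrier G"
  obtains w where "w \<in> lists S" "length w = wd x y" "x \<otimes> weval G e w = y"
proof -
  obtain w where w: "w \<in> lists S" "weval G e w = inv x \<otimes> y"
    using word_exists[of "inv x \<otimes> y"] assms by blast
  have "x \<otimes> weval G e w = y"
    using assms unfolding w(2) by (simp flip: m_assoc)
  then have "\<exists>n. \<exists>w\<in>lists S. length w = n \<and> x \<otimes> weval G e w = y" using w(1) by blast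
  from LeastI_ex[OF this] show thesis using that unfolding wdist_def by blast
qed

lemma wd_refl: "x \<in> carrier G \<Longrightarrow> wd x x = 0"
  using wd_le[of "[]" x x] by simp

lemma wd_sym_le:
  assumes "x \<in> carrier G" "y \<in> carrier G"
  shows "wd y x \<le> wd x y"
proof -
  obtain w where w: "w \<in> lists S" "length w = wd x y" "x \<otimes> weval G e w = y"
    using wd_attained[OF assms] .
  have "rev (map iv w) \<in> lists S" using w(1) iv_closed by auto
  moreover have "y \<otimes> weval G e (rev (map iv w)) = x"
    using inv_solve_right[of x y "weval G e w"] assms w by (simp add: weval_inverse_word)
  ultimately show ?thesis
    using wd_le[of "rev (map iv w)" y x] w(2) by simp
qed

lemma wd_tri:
  assumes "x \<in> carrier G" "y \<in> carrier G" "z \<in> carrier G"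
  shows "wd x z \<le> wd x y + wd y z"
proof -
  obtain v where v: "v \<in> lists S" "length v = wd x y" "x \<otimes> weval G e v = y"
    by (rule wd_attained[OF assms(1,2)])
  obtain w where w: "w \<in> lists S" "length w = wd y z" "y \<otimes> weval G e w = z"
    by (rule wd_attained[OF assms(2,3)])
  have "x \<otimes> weval G e (v @ w) = (x \<otimes> weval G e v) \<otimes> weval G e w"
    using assms(1) weval_closed v(1) w(1) weval_append[OF v(1) w(1)] m_assoc by simp
  then have "x \<otimes> weval G e (v @ w) = z" using v(3) w(3) by simp
  then show ?thesis using wd_le[of "v @ w" x z] v w by simp
qed

text \<open>Composing with a retraction onto the carrier makes the word metric a pseudometric on the
  whole type, so that no carrier conditions are needed in the metric part.\<close>
definition pr :: "'g \<Rightarrow> 'g" where "pr x = (if x \<in> carrier G then x else \<one>)"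

definition dd :: "'g \<Rightarrow> 'g \<Rightarrow> nat" where "dd x y = wd (pr x) (pr y)"

lemma pr_closed [simp]: "pr x \<in> carrier G"
  and pr_id [simp]: "x \<in> carrier G \<Longrightarrow> pr x = x"
  by (auto simp: pr_def)

sublocale pseudometric dd
proof
  show "dd x y = dd y x" for x y
    unfolding dd_def by (intro antisym wd_sym_le) simp_all
qed (simp_all add: dd_def wd_refl wd_tri)

lemma dd_wd: "x \<in> carrier G \<Longrightarrow> y \<in> carrier G \<Longrightarrow> dd x y = wd x y"
  by (simp add: dd_def)

lemma lists_take: "w \<in> lists S \<Longrightarrow> take i w \<in> lists S"
  and lists_drop: "w \<in> lists S \<Longrightarrow> drop i w \<in> lists S"
  by (auto dest: in_set_takeD in_set_dropD)

lemma path_pts_closed: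
  "fst p \<in> carrier G \<Longrightarrow> snd p \<in> lists S \<Longrightarrow> a \<in> path_pts G e p \<Longrightarrow> a \<in> carrier G"
  by (auto simp: path_pts_image simp del: in_lists_conv_set intro!: m_closed weval_closed lists_take)

lemma path_step:
  assumes "x \<in> carrier G" "w \<in> lists S" "i \<le> j"
  shows "dd (x \<otimes> weval G e (take i w)) (x \<otimes> weval G e (take j w)) \<le> j - i"
proof -
  let ?v = "drop i (take j w)"
  have v: "?v \<in> lists S" "take i w \<in> lists S" "take j w \<in> lists S"
    using assms lists_take lists_drop by blast+
  have "take j w = take i w @ ?v"
    using assms(3) by (metis append_take_drop_id min.absorb1 take_take)
  then have "x \<otimes> weval G e (take j w) = (x \<otimes> weval G e (take i w)) \<otimes> weval G e ?v"
    using assms(1) v weval_append[of "take i w" ?v] by (simp add: m_assoc)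
  then have "wd (x \<otimes> weval G e (take i w)) (x \<otimes> weval G e (take j w)) \<le> length ?v"
    using wd_le v by metis
  then show ?thesis using assms v by (simp add: dd_wd)
qed

lemma path_linked:
  assumes "x \<in> carrier G" "w \<in> lists S"
  shows "linked (path_pts G e (x, w)) x (path_end G e (x, w))"
  unfolding linked_def
proof (intro allI impI)
  let ?A = "path_pts G e (x, w)" and ?y = "path_end G e (x, w)"
  fix U V assume cov: "?A \<subseteq> U \<union> V" and U: "\<forall>u. dd x u = 0 \<longrightarrow> u \<in> U"
    and V: "\<forall>v. dd ?y v = 0 \<longrightarrow> v \<in> V"
  let ?c = "\<lambda>i. x \<otimes> weval G e (take i w)"
  have c: "?c i \<in> ?A" if "i \<le> length w" for i
    using that by (auto simp: path_pts_image)
  have "?c 0 \<in> U" using U assms by simp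
  moreover have "?c (length w) \<in> V" using V by (simp add: path_end_def)
  moreover have "?c i \<in> U \<or> ?c i \<in> V" if "i \<le> length w" for i
    using c[OF that] cov by auto
  ultimately obtain i j where ij: "i \<le> length w" "j \<le> length w" "?c i \<in> U" "?c j \<in> V"
      "j = i \<or> j = Suc i"
    using chain_switch[of "\<lambda>i. ?c i \<in> U" "\<lambda>i. ?c i \<in> V" "length w"] by blast
  have "dd (?c i) (?c j) \<le> 1"
    using path_step[OF assms, of i j] ij(5) by auto
  then show "\<exists>a\<in>?A \<inter> U. \<exists>b\<in>?A \<inter> V. dd a b \<le> 1"
    using ij c by blast
qed

lemma geodesic_seg:
  assumes "x \<in> carrier G" "w \<in> lists S" "y = path_end G e (x, w)" "length w = wd x y"
  shows "seg (path_pts G e (x, w)) x y"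
proof -
  let ?c = "\<lambda>i. x \<otimes> weval G e (take i w)"
  have y: "?c (length w) = y" "y \<in> carrier G"
    using assms(1-3) by (simp_all add: path_end_def)
  have n: "dd x y = length w" using assms(1,4) y(2) by (simp add: dd_wd)
  have x: "?c 0 = x" using assms(1) by simp
  \<comment> \<open>The three pieces cut off by \<open>i\<close> and \<open>j\<close> have lengths
    at most \<open>i\<close>, \<open>j - i\<close> and \<open>length w - j\<close>. These bounds add
    up to the distance of the ends, so all are equalities.\<close>
  have between: "dd (?c i) (?c j) = j - i" if "i \<le> j" "j \<le> length w" for i j
  proof -
    have "dd x (?c i) \<le> i" using path_step[OF assms(1,2), of 0 i] x by (metis diff_zero le0)
    moreover have "dd (?c j) y \<le> length w - j" using path_step[OF assms(1,2) that(2)] y by metis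
    moreover have "dd (?c i) (?c j) \<le> j - i" using path_step[OF assms(1,2) that(1)] .
    ultimately show ?thesis
      using d_tri[of x y "?c i"] d_tri[of "?c i" y "?c j"] n that by linarith
  qed
  have xc: "dd x (?c i) = i" and cy: "dd (?c i) y = length w - i" if "i \<le> length w" for i
    using between[of 0 i] between[of i "length w"] that by (simp_all only: x y diff_zero le0)
  show ?thesis
    unfolding seg_def path_pts_image fst_conv snd_conv using xc cy between n by auto
qed

lemma joins_word:
  assumes "joins G (e ` S) id s x y"
  obtains w where "w \<in> lists S" "snd s = map e w" "fst s \<in> carrier G"
proof -
  have "snd s \<in> lists (e ` S)" "fst s \<in> carrier G" using assms by (simp_all add: joins_def)
  then show thesis using that unfolding lists_image_map by blast
qed

text \<open>A side may be traversed in either direction, which \<open>seg_sym\<close>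
  compensates.\<close>

lemma joins_geodesic_seg:
  assumes "joins G (e ` S) id s x y" "geodesic G (e ` S) id s"
  shows "seg (path_pts G id s) x y"
proof -
  obtain w where w: "w \<in> lists S" "snd s = map e w"
    by (rule joins_word[OF assms(1)])
  have s: "s = (fst s, map e w)" using w(2) by (metis prod.collapse)
  have fs: "fst s \<in> carrier G" using assms(1) by (simp add: joins_def)
  have pe: "path_end G id s = path_end G e (fst s, w)"
    unfolding path_end_def w(2) by (simp add: weval_map)
  have "length w = wd (fst s) (path_end G e (fst s, w))"
    using assms(2) unfolding geodesic_def pe w(2) by (simp add: wdist_image)
  from geodesic_seg[OF fs w(1) refl this]
  have sg: "seg (path_pts G id s) (fst s) (path_end G id s)"
    unfolding pe by (subst s) (simp add: path_pts_map)
  from assms(1) have "fst s = x \<and> path_end G id s = y \<or> fst s = y \<and> path_end G id s = x"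
    by (simp add: joins_def)
  then show ?thesis using sg seg_sym by auto
qed

text \<open>The image of \<open>S\<close> under \<open>e\<close> serves as generating set and
  \<open>M\<close> as thinness constant. One-sided thinness yields all three clauses of
  \<open>thin\<close> by rotating the triangle.\<close>

lemma word_hyperbolicI:
  assumes "\<And>x y z A B E a. seg A x y \<Longrightarrow> seg B y z \<Longrightarrow> seg E z x \<Longrightarrow> a \<in> A \<Longrightarrow>
    \<exists>b\<in>B \<union> E. dd a b \<le> M"
  shows "word_hyperbolic G"
  unfolding word_hyperbolic_def
proof (intro exI[of _ "e ` S"] exI[of _ "real M"] conjI ballI allI impI)
  show "e ` S \<subseteq> carrier G" "finite (e ` S)" using finite_S by auto
  show "inv s \<in> e ` S" if "s \<in> e ` S" for s
    using that e_iv iv_closed by (metis (no_types, lifting) image_iff)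
  show "\<exists>w\<in>lists (e ` S). weval G id w = g" if "g \<in> carrier G" for g
    using word_exists[OF that] by (auto simp: lists_image weval_map)
  fix x y z s1 s2 s3
  assume "triangle G (e ` S) id x y z s1 s2 s3 \<and> geodesic G (e ` S) id s1 \<and>
    geodesic G (e ` S) id s2 \<and> geodesic G (e ` S) id s3"
  then have j: "joins G (e ` S) id s1 x y" "joins G (e ` S) id s2 y z" "joins G (e ` S) id s3 z x"
    and g: "geodesic G (e ` S) id s1" "geodesic G (e ` S) id s2" "geodesic G (e ` S) id s3"
    by (auto simp: triangle_def)
  have closed: "a \<in> carrier G" if js: "joins G (e ` S) id s u v" and a: "a \<in> path_pts G id s" for s u v a
  proof -
    obtain w where w: "w \<in> lists S" "snd s = map e w" "fst s \<in> carrier G"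
      by (rule joins_word[OF js])
    then have "path_pts G id s = path_pts G e (fst s, w)" by (metis path_pts_map prod.collapse)
    then show ?thesis using path_pts_closed[of "(fst s, w)"] w a by simp
  qed
  note sg = joins_geodesic_seg[OF j(1) g(1)] joins_geodesic_seg[OF j(2) g(2)]
    joins_geodesic_seg[OF j(3) g(3)]
  have wd: "real (wdist G (e ` S) id a b) \<le> real M"
    if "a \<in> carrier G" "b \<in> carrier G" "dd a b \<le> M" for a b
    using that by (simp add: wdist_image dd_wd)
  show "thin G (e ` S) id s1 s2 s3 (real M)"
    unfolding thin_def
  proof (intro conjI ballI)
    fix p assume p: "p \<in> path_pts G id s1"
    show "\<exists>q\<in>path_pts G id s2 \<union> path_pts G id s3. real (wdist G (e ` S) id p q) \<le> real M"
      using assms[OF sg p] wd closed j p by blast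
  next
    fix p assume p: "p \<in> path_pts G id s2"
    show "\<exists>q\<in>path_pts G id s1 \<union> path_pts G id s3. real (wdist G (e ` S) id p q) \<le> real M"
      using assms[OF sg(2,3,1) p] wd closed j p by blast
  next
    fix p assume p: "p \<in> path_pts G id s3"
    show "\<exists>q\<in>path_pts G id s1 \<union> path_pts G id s2. real (wdist G (e ` S) id p q) \<le> real M"
      using assms[OF sg(3,1,2) p] wd closed j p by blast
  qed
qed

end

section \<open>The combing as a thin path system\<close>

theorem theorem3p1:
  fixes G :: "('g, 'b) monoid_scheme"
    and S :: "'a set" and iv :: "'a \<Rightarrow> 'a" and e :: "'a \<Rightarrow> 'g"
    and R :: "'a list set" and C :: real
  assumes "group G"
    and "gen_choice G S iv e"
    and "combing G S e R"
    and "\<And>x y z s1 s2 s3. R_triangle G S e R x y z s1 s2 s3 \<Longrightarrow>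
           real (width G S e s1 s2 s3) \<le> real (tnorm G S e x y z) / 75 + C"
  shows "word_hyperbolic G"
proof -
  interpret generated_group G S iv e
    using assms(1,2) by (simp add: generated_group_def generated_group_axioms_def)
  obtain r where r: "\<And>g. g \<in> carrier G \<Longrightarrow> r g \<in> R \<and> weval G e (r g) = g"
    using assms(3) unfolding combing_def by metis
  have RS: "R \<subseteq> lists S" using assms(3) by (simp add: combing_def)
  \<comment> \<open>The chosen word depends only on the group element leading from \<open>x\<close>
    to \<open>y\<close>. Hence finitely many words serve all pairs at distance at most 1.\<close>
  define lab where "lab x y = r (inv\<^bsub>G\<^esub> (pr x) \<otimes>\<^bsub>G\<^esub> pr y)" for x y
  define pth where "pth x y = (pr x, lab x y)" for x y
  have lab: "lab x y \<in> R" "lab x y \<in> lists S"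
    "weval G e (lab x y) = inv\<^bsub>G\<^esub> (pr x) \<otimes>\<^bsub>G\<^esub> pr y" for x y
    using r[of "inv\<^bsub>G\<^esub> (pr x) \<otimes>\<^bsub>G\<^esub> pr y"] RS unfolding lab_def by auto
  have pth_end: "path_end G e (pth x y) = pr y" for x y
    using inv_solve_left[of "weval G e (lab x y)" "pr x" "pr y"] lab weval_closed
    by (simp add: pth_def path_end_def)
  have joins: "joins G S e (pth x y) (pr x) (pr y)" "joins G S e (pth y x) (pr x) (pr y)" for x y
    using lab(2) by (simp_all add: joins_def pth_end) (simp_all add: pth_def)
  have closed: "a \<in> carrier G" if "a \<in> path_pts G e (pth x y)" for a x y
    using path_pts_closed[OF _ _ that] lab by (simp add: pth_def)
  \<comment> \<open>The words chosen for the two directions need not be inverse to each other;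
    taking both paths makes \<open>P\<close> symmetric.\<close>
  define P where "P x y = path_pts G e (pth x y) \<union> path_pts G e (pth y x)" for x y

  \<comment> \<open>Finitely many group elements are values of words of length at most 1, so
    \<open>L\<close> can bound the lengths of their combing words.\<close>
  let ?F = "weval G e ` {w. set w \<subseteq> S \<and> length w \<le> 1}"
  have "finite ((\<lambda>h. length (r h)) ` ?F)"
    by (intro finite_imageI finite_lists_length_le finite_S)
  then have "\<exists>L. \<forall>n\<in>(\<lambda>h. length (r h)) ` ?F. n \<le> L"
    by (simp only: finite_nat_set_iff_bounded_le)
  then obtain L where "\<forall>n\<in>(\<lambda>h. length (r h)) ` ?F. n \<le> L" by (rule exE)
  then have L: "length (r h) \<le> L" if "h \<in> ?F" for h 
    using that by (simp only: ball_simps) blast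
  have start: "dd x a \<le> L" if xy: "dd x y \<le> 1" and a: "a \<in> path_pts G e (pth x y)" for x y a
  proof -
    obtain w where w: "w \<in> lists S" "length w = wd (pr x) (pr y)" "pr x \<otimes>\<^bsub>G\<^esub> weval G e w = pr y"
      by (rule wd_attained[of "pr x" "pr y"]) auto
    have "inv\<^bsub>G\<^esub> (pr x) \<otimes>\<^bsub>G\<^esub> pr y = weval G e w"
      using inv_solve_left[of "weval G e w" "pr x" "pr y"] w(1,3) by simp
    moreover have "length w \<le> 1" using w(2) xy by (simp add: dd_def)
    ultimately have "length (lab x y) \<le> L" using L w(1) unfolding lab_def by auto
    moreover obtain i where i: "i \<le> length (lab x y)" "a = pr x \<otimes>\<^bsub>G\<^esub> weval G e (take i (lab x y))"
      using a by (auto simp: path_pts_def pth_def)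
    moreover have "wd (pr x) a \<le> i"
      using path_step[of "pr x" "lab x y" 0 i] lab(2) closed[OF a]
      by (simp add: dd_wd flip: i(2))
    ultimately show ?thesis using closed[OF a] by (simp add: dd_def)
  qed

  \<comment> \<open>The absolute value covers a negative \<open>C\<close>; \<open>L\<close> bounds
    short paths from their starting point, and the extra 1 allows for a path that starts at the
    other end.\<close>
  define C' where "C' = \<bar>C\<bar> + real L + 1"
  interpret thin_paths dd P C'
  proof
    show "C' \<ge> 0" by (simp add: C'_def)
    show "P x y = P y x" for x y by (auto simp: P_def)
    show "linked (P x y) x y" for x y
    proof -
      have "linked (path_pts G e (pth x y)) (pr x) (pr y)"
        using path_linked[of "pr x" "lab x y"] lab pth_end[of x y] by (simp add: pth_def)
      then show ?thesis by (rule linked_mono) (simp_all add: P_def dd_def wd_refl)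
    qed
    show "real (dd x a) \<le> C'" if "dd x y \<le> 1" "a \<in> P x y" for x y a
    proof -
      have "dd x a \<le> L + 1"
        using start[of x y a] start[of y x a] that d_sym[of x y] d_tri[of x a y]
        unfolding P_def by auto
      then show ?thesis unfolding C'_def by linarith
    qed
    show "\<exists>b\<in>P x z \<union> P y z. real (dd a b) \<le> real (max (dd x y) (max (dd y z) (dd x z))) / 75 + C'"
      if a: "a \<in> P x y" for a x y z
    proof -
      \<comment> \<open>Whichever of the two paths contains \<open>a\<close>, it is a valid side
        between \<open>x\<close> and \<open>y\<close>, since \<open>joins\<close> admits both
        directions.\<close>
      obtain s where s: "s = pth x y \<or> s = pth y x" "a \<in> path_pts G e s"
        using a unfolding P_def by blast
      have "R_triangle G S e R (pr x) (pr y) (pr z) s (pth y z) (pth z x)"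
        using s(1) joins lab(1) unfolding R_triangle_def triangle_def by (auto simp: pth_def)
      note bound = assms(4)[OF this]
      obtain b where
        b: "b \<in> path_pts G e (pth y z) \<union> path_pts G e (pth z x)"
          "real (wd a b) \<le> real (tnorm G S e (pr x) (pr y) (pr z)) / 75 + C"
      proof -
        obtain b where b: "b \<in> path_pts G e (pth y z) \<union> path_pts G e (pth z x)"
            "real (wd a b) \<le> real (width G S e s (pth y z) (pth z x))"
          using thin_width[of G S e s "pth y z" "pth z x"] s(2) unfolding thin_def by blast
        show thesis using that[OF b(1)] b(2) bound by linarith
      qed
      have "tnorm G S e (pr x) (pr y) (pr z) = max (dd x y) (max (dd y z) (dd x z))"
        using d_sym[of x z] by (simp add: tnorm_def dd_def)
      moreover have "dd a b = wd a b"
        using closed s b(1) by (intro dd_wd) auto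
      ultimately have "real (dd a b) \<le> real (max (dd x y) (max (dd y z) (dd x z))) / 75 + C'"
        using b(2) unfolding C'_def by linarith
      then show ?thesis using b(1) unfolding P_def by blast
    qed
    show "\<exists>A. seg A x y" for x y
    proof -
      obtain w where w: "w \<in> lists S" "length w = wd (pr x) (pr y)" "pr x \<otimes>\<^bsub>G\<^esub> weval G e w = pr y"
        by (rule wd_attained[of "pr x" "pr y"]) auto
      then have "seg (path_pts G e (pr x, w)) (pr x) (pr y)"
        by (intro geodesic_seg) (auto simp: path_end_def)
      then show ?thesis unfolding seg_def dd_def by auto
    qed
  qed
  obtain M where "\<And>n. thin_upto n M" using uniformly_thin by blast
  \<comment> \<open>As \<open>M\<close> is independent of \<open>n\<close>, the norm of the given
    triangle may be taken for \<open>n\<close>.\<close>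
  then have "\<exists>b\<in>B \<union> E. dd a b \<le> M"
    if "seg A x y" "seg B y z" "seg E z x" "a \<in> A" for x y z A B E a
    using thin_uptoD[of "max (dd x y) (max (dd y z) (dd z x))" M A x y B z E a] that by simp
  then show ?thesis by (rule word_hyperbolicI)
qed

end
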